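(* Let $L:\Theta\to\mathbb{R}$, maps $T_1,\dots,T_k:\Theta\to\Theta$, a starting value $\theta_0\in\Theta$, and the sequence $(\theta_n)_{n\in\mathbb{N}}$ given by $\theta_{n+1}=T_k\cdots T_1(\theta_n)$, $n\ge0$, be as in the iterative partial maximization setting described in the context, and let $\mathcal{A}_\infty$ be the set of accumulation points of $(\theta_n)_{n\in\mathbb{N}}$. Then the sequence $(L(\theta_n))_{n\in\mathbb{N}}$ converges to a limit $\ell_\infty\in\mathbb{R}$. Furthermore, if $\alpha\in\mathcal{A}_\infty$, then $L(\alpha)=\ell_\infty$ and $\alpha$ satisfies the likelihood equations $$\frac{\partial L(\theta)}{\partial\theta}\bigg|_{\theta=\alpha}=0.$$
   Context: Iterative partial maximization setting. $\Theta\subseteq\mathbb{R}^d$ is an open set and $L:\Theta\to\mathbb{R}$ is a differentiable function. The point $\theta_0\in\Theta$ is such that $\Theta_0=\{\theta\in\Theta\mid L(\theta)\ge L(\theta_0)\}$ is compact. For functions $g_i:\Theta\to\mathbb{R}^{d_i}$, $i=1,\dots,k$, and $\theta^*\in\Theta$, define the sections $$\Theta_i(\theta^* )=\{\theta\in\Theta\mid g_i(\theta)=g_i(\theta^* )\}.$$ Assume: (i) for all $\theta^*\in\Theta$ and $i=1,\dots,k$, the maximum of $L$ over $\Theta_i(\theta^* )$ is uniquely attained, and the associated map $T_i:\Theta\to\Theta$, $T_i(\theta^* )=\mathop{\mathrm{argmax}}_{\theta\in\Theta_i(\theta^* )}L(\theta)$, is continuous for every $i=1,\dots,k$; (ii)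 if $\theta^*\in\Theta$ maximizes $L$ over all sections $\Theta_i(\theta^* )$, $i=1,\dots,k$ (equivalently $\theta^*=T_i(\theta^* )$ for all $i$), then $\theta^*$ solves the likelihood equations $\frac{\partial L(\theta)}{\partial\theta}\big|_{\theta=\theta^*}=0$. The sequence is defined by $\theta_{n+1}=T_k\cdots T_1(\theta_n)$ (composition of maps) for $n\ge0$, starting at $\theta_0$. An accumulation point of the sequence is a limit of a convergent subsequence; since $\theta_n\in\Theta_0$ for all $n$ and $\Theta_0$ is compact, $\mathcal{A}_\infty\subseteq\Theta_0$. *)

theory Defs
  imports "HOL-Analysis.Analysis"
begin

(* R^m for a dimension m that varies with an index: functions supported on {1..m},
   so that HOL equality is equality of the m coordinates. *)
definition coord_space :: "nat \<Rightarrow> (nat \<Rightarrow> real) set" where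
  "coord_space m = {1..m} \<rightarrow>\<^sub>E UNIV"

definition level_section :: "'a set \<Rightarrow> ('a \<Rightarrow> 'b) \<Rightarrow> 'a \<Rightarrow> 'a set" where
  "level_section \<Theta> g t = {s \<in> \<Theta>. g s = g t}"

definition likelihood_eq :: "(real ^ 'n \<Rightarrow> real) \<Rightarrow> real ^ 'n \<Rightarrow> bool" where
  "likelihood_eq L t \<longleftrightarrow> GDERIV L t :> 0"

primrec sweep :: "(nat \<Rightarrow> 'a \<Rightarrow> 'a) \<Rightarrow> nat \<Rightarrow> 'a \<Rightarrow> 'a" where
  "sweep T 0 = id"
| "sweep T (Suc k) = T (Suc k) \<circ> sweep T k"

definition accumulation_points :: "(nat \<Rightarrow> 'a::topological_space) \<Rightarrow> 'a set" where
  "accumulation_points x = {a. \<exists>r. strict_mono r \<and> (x \<circ> r) \<longlonglongrightarrow> a}"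

end

theory Submission
  imports Defs
begin

text \<open>
  A maximum over a section that is uniquely attained makes the corresponding update a strict
  ascent: \<open>T i\<close> raises the value of \<open>L\<close> unless it fixes the point. A full sweep inherits this,
  since the gains of its steps cannot cancel: a sweep that leaves \<open>L\<close> unchanged at \<open>t\<close> leaves \<open>t\<close>
  fixed at each of its steps (\<open>sweep_strict_ascent\<close>).

  Along the iteration \<open>L\<close> is therefore nondecreasing, and it is bounded because the sequence stays
  in a compact superlevel set, so the values converge to some \<open>l\<close>. At an accumulation point \<open>\<alpha>\<close>
  both \<open>L \<alpha>\<close> and \<open>L (S \<alpha>)\<close>, with \<open>S\<close> the sweep, are limits of values of \<open>L\<close> along the sequence,
  by continuity of \<open>L\<close> and \<open>S\<close>; hence both equal \<open>l\<close> (\<open>ascent_iteration_accumulation\<close>). No gain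
  at \<open>\<alpha>\<close> means that every \<open>T i\<close> fixes \<open>\<alpha>\<close>, so \<open>\<alpha>\<close> maximizes \<open>L\<close> over all of its sections and
  solves the likelihood equations.
\<close>

lemma arg_max_on_is_arg_max:
  assumes "\<exists>!s. is_arg_max f (\<lambda>u. u \<in> S) s"
  shows "is_arg_max f (\<lambda>u. u \<in> S) (arg_max_on f S)"
  using assms unfolding arg_max_on_def arg_max_def by (metis someI_ex)

text \<open>
  The point \<open>t\<close> lies in its own section, so it competes with the maximizer; if it attains the
  same value, it is a maximizer too, and uniqueness identifies the two.
\<close>

lemma section_arg_max_strict_ascent:
  fixes L :: "'a \<Rightarrow> 'b::linorder"
  assumes "t \<in> \<Theta>"
    and unique: "\<exists>!s. is_arg_max L (\<lambda>u. u \<in> level_section \<Theta> g t) s"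
  defines "m \<equiv> arg_max_on L (level_section \<Theta> g t)"
  shows "m \<in> \<Theta>" and "L t \<le> L m" and "L m = L t \<Longrightarrow> m = t"
proof -
  have m: "is_arg_max L (\<lambda>u. u \<in> level_section \<Theta> g t) m"
    unfolding m_def by (rule arg_max_on_is_arg_max[OF unique])
  have t: "t \<in> level_section \<Theta> g t"
    using \<open>t \<in> \<Theta>\<close> by (simp add: level_section_def)
  show "m \<in> \<Theta>"
    using m by (simp add: is_arg_max_def level_section_def)
  show "L t \<le> L m"
    using m t by (auto simp: is_arg_max_linorder)
  show "m = t" if "L m = L t"
  proof -
    have "is_arg_max L (\<lambda>u. u \<in> level_section \<Theta> g t) t"
      using m t that by (auto simp: is_arg_max_linorder)
    with unique m show ?thesis by blast
  qed
qed

text \<open>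
  The equality case goes by induction from the last step backwards: if the whole sweep gains
  nothing, then neither does the sweep without its last step, so that one fixes \<open>t\<close>, and the
  last step is then applied to \<open>t\<close> itself.
\<close>

lemma sweep_strict_ascent:
  fixes L :: "'a \<Rightarrow> 'b::linorder"
  assumes maps: "\<And>i t. i \<in> {1..k} \<Longrightarrow> t \<in> \<Theta> \<Longrightarrow> T i t \<in> \<Theta>"
    and ascent: "\<And>i t. i \<in> {1..k} \<Longrightarrow> t \<in> \<Theta> \<Longrightarrow> L t \<le> L (T i t)"
    and strict: "\<And>i t. i \<in> {1..k} \<Longrightarrow> t \<in> \<Theta> \<Longrightarrow> L (T i t) = L t \<Longrightarrow> T i t = t"
    and "t \<in> \<Theta>"
  shows "sweep T k t \<in> \<Theta> \<and> L t \<le> L (sweep T k t) \<and>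
    (L (sweep T k t) = L t \<longrightarrow> sweep T k t = t \<and> (\<forall>i\<in>{1..k}. T i t = t))"
  using maps ascent strict
proof (induction k)
  case 0
  then show ?case using \<open>t \<in> \<Theta>\<close> by simp
next
  case (Suc k)
  let ?s = "sweep T k t"
  have IH: "?s \<in> \<Theta>" "L t \<le> L ?s"
    "L ?s = L t \<Longrightarrow> ?s = t \<and> (\<forall>i\<in>{1..k}. T i t = t)"
    using Suc.IH Suc.prems by simp_all
  have gain: "L ?s \<le> L (T (Suc k) ?s)"
    using Suc.prems(2) IH(1) by simp
  have "T (Suc k) ?s = t \<and> (\<forall>i\<in>{1..Suc k}. T i t = t)" if eq: "L (T (Suc k) ?s) = L t"
  proof -
    have "L ?s = L t"
      using IH(2) gain eq by simp
    then have fixed: "?s = t" "\<forall>i\<in>{1..k}. T i t = t"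
      using IH(3) by simp_all
    then have "T (Suc k) t = t"
      using Suc.prems(3)[of "Suc k" t] eq \<open>t \<in> \<Theta>\<close> by simp
    with fixed show ?thesis
      by (auto simp: atLeastAtMostSuc_conv)
  qed
  then show ?case
    using Suc.prems(1) IH(1,2) gain by auto
qed

lemma continuous_on_sweep:
  assumes maps: "\<And>i t. i \<in> {1..k} \<Longrightarrow> t \<in> \<Theta> \<Longrightarrow> T i t \<in> \<Theta>"
    and cont: "\<And>i. i \<in> {1..k} \<Longrightarrow> continuous_on \<Theta> (T i)"
  shows "continuous_on \<Theta> (sweep T k) \<and> sweep T k ` \<Theta> \<subseteq> \<Theta>"
  using assms
proof (induction k)
  case 0
  then show ?case by (simp add: id_def)
next
  case (Suc k)
  then have IH: "continuous_on \<Theta> (sweep T k)" "sweep T k ` \<Theta> \<subseteq> \<Theta>"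
    by simp_all
  have "continuous_on (sweep T k ` \<Theta>) (T (Suc k))"
    using Suc.prems(2)[of "Suc k"] IH(2) continuous_on_subset by auto
  then have "continuous_on \<Theta> (sweep T (Suc k))"
    using IH(1) continuous_on_compose by auto
  moreover have "sweep T (Suc k) ` \<Theta> \<subseteq> \<Theta>"
    using Suc.prems(1)[of "Suc k"] IH(2) by auto
  ultimately show ?case by blast
qed

text \<open>
  Along a subsequence \<open>x \<circ> r\<close> tending to \<open>\<alpha>\<close>, the shifted terms \<open>x (Suc (r n)) = S (x (r n))\<close>
  tend to \<open>S \<alpha>\<close>, and the values of \<open>L\<close> along both have the limit of the full sequence of values.
\<close>

lemma ascent_iteration_accumulation:
  fixes L :: "'a::t2_space \<Rightarrow> real"
  assumes contL: "continuous_on \<Theta> L"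
    and contS: "continuous_on \<Theta> S"
    and maps: "\<And>t. t \<in> \<Theta> \<Longrightarrow> S t \<in> \<Theta>"
    and ascent: "\<And>t. t \<in> \<Theta> \<Longrightarrow> L t \<le> L (S t)"
    and start: "x 0 \<in> \<Theta>"
    and comp: "compact {t \<in> \<Theta>. L t \<ge> L (x 0)}"
    and step: "\<And>n. x (Suc n) = S (x n)"
  obtains l where "(\<lambda>n. L (x n)) \<longlonglongrightarrow> l"
    and "\<And>\<alpha>. \<alpha> \<in> accumulation_points x \<Longrightarrow> \<alpha> \<in> \<Theta> \<and> L \<alpha> = l \<and> L (S \<alpha>) = l"
proof -
  let ?K = "{t \<in> \<Theta>. L t \<ge> L (x 0)}"
  have in_\<Theta>: "x n \<in> \<Theta>" for n
    by (induction n) (simp_all add: start step maps)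
  have inc: "incseq (\<lambda>n. L (x n))"
    by (rule incseq_SucI) (simp add: step ascent in_\<Theta>)
  have in_K: "x n \<in> ?K" for n
    using in_\<Theta> incseqD[OF inc, of 0 n] by simp
  have "compact (L ` ?K)"
    by (rule compact_continuous_image[OF continuous_on_subset[OF contL] comp]) auto
  then obtain B where "\<And>t. t \<in> ?K \<Longrightarrow> L t \<le> B"
    using bounded_imp_bdd_above[OF compact_imp_bounded] by (fastforce simp: bdd_above_def)
  then obtain l where l: "(\<lambda>n. L (x n)) \<longlonglongrightarrow> l"
    using incseq_convergent[OF inc, of B] in_K by blast
  have "\<alpha> \<in> \<Theta> \<and> L \<alpha> = l \<and> L (S \<alpha>) = l" if acc: "\<alpha> \<in> accumulation_points x" for \<alpha>
  proof -
    obtain r where r: "strict_mono r" and lim: "(\<lambda>n. x (r n)) \<longlonglongrightarrow> \<alpha>"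
      using acc by (auto simp: accumulation_points_def o_def)
    have "\<alpha> \<in> ?K"
      by (rule Lim_in_closed_set[OF compact_imp_closed[OF comp] _ _ lim]) (use in_K in auto)
    then have \<alpha>: "\<alpha> \<in> \<Theta>" by simp
    have "(\<lambda>n. L (x (r n))) \<longlonglongrightarrow> L \<alpha>"
      by (rule continuous_on_tendsto_compose[OF contL lim \<alpha>]) (simp add: in_\<Theta>)
    moreover have "(\<lambda>n. L (x (r n))) \<longlonglongrightarrow> l"
      using LIMSEQ_subseq_LIMSEQ[OF l r] by (simp add: o_def)
    ultimately have "L \<alpha> = l"
      by (rule LIMSEQ_unique)
    have "(\<lambda>n. S (x (r n))) \<longlonglongrightarrow> S \<alpha>"
      by (rule continuous_on_tendsto_compose[OF contS lim \<alpha>]) (simp add: in_\<Theta>)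
    then have "(\<lambda>n. L (S (x (r n)))) \<longlonglongrightarrow> L (S \<alpha>)"
      by (rule continuous_on_tendsto_compose[OF contL]) (simp_all add: in_\<Theta> maps \<alpha>)
    moreover have "(\<lambda>n. L (S (x (r n)))) \<longlonglongrightarrow> l"
      using LIMSEQ_subseq_LIMSEQ[OF LIMSEQ_Suc[OF l] r] by (simp add: o_def step)
    ultimately have "L (S \<alpha>) = l"
      by (rule LIMSEQ_unique)
    with \<alpha> \<open>L \<alpha> = l\<close> show ?thesis by simp
  qed
  with l show thesis by (rule that)
qed

theorem proposition1:
  fixes \<Theta> :: "(real ^ 'n) set"
    and L :: "real ^ 'n \<Rightarrow> real"
    and k :: nat
    and d :: "nat \<Rightarrow> nat"
    and g :: "nat \<Rightarrow> real ^ 'n \<Rightarrow> (nat \<Rightarrow> real)"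
    and T :: "nat \<Rightarrow> real ^ 'n \<Rightarrow> real ^ 'n"
    and \<theta> :: "nat \<Rightarrow> real ^ 'n"
  assumes "open \<Theta>"
    and "L differentiable_on \<Theta>"
    and "\<theta> 0 \<in> \<Theta>"
    and "compact {t \<in> \<Theta>. L t \<ge> L (\<theta> 0)}"
    and "\<And>i. i \<in> {1..k} \<Longrightarrow> g i \<in> \<Theta> \<rightarrow> coord_space (d i)"
    and "\<And>i t. i \<in> {1..k} \<Longrightarrow> t \<in> \<Theta> \<Longrightarrow>
           \<exists>!s. is_arg_max L (\<lambda>u. u \<in> level_section \<Theta> (g i) t) s"
    and "\<And>i t. i \<in> {1..k} \<Longrightarrow> t \<in> \<Theta> \<Longrightarrow> T i t = arg_max_on L (level_section \<Theta> (g i) t)"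
    and "\<And>i. i \<in> {1..k} \<Longrightarrow> continuous_on \<Theta> (T i)"
    and "\<And>t. t \<in> \<Theta> \<Longrightarrow>
           (\<forall>i\<in>{1..k}. is_arg_max L (\<lambda>u. u \<in> level_section \<Theta> (g i) t) t) \<Longrightarrow>
           likelihood_eq L t"
    and "\<And>n. \<theta> (Suc n) = sweep T k (\<theta> n)"
  shows "\<exists>l::real. (\<lambda>n. L (\<theta> n)) \<longlonglongrightarrow> l \<and>
           (\<forall>\<alpha> \<in> accumulation_points \<theta>. L \<alpha> = l \<and> likelihood_eq L \<alpha>)"
proof -
  note unique = assms(6) and T_eq = assms(7)
  have maps: "T i t \<in> \<Theta>" if "i \<in> {1..k}" "t \<in> \<Theta>" for i t
    using section_arg_max_strict_ascent(1)[OF that(2) unique[OF that]] T_eq[OF that] by simp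
  have ascent: "L t \<le> L (T i t)" if "i \<in> {1..k}" "t \<in> \<Theta>" for i t
    using section_arg_max_strict_ascent(2)[OF that(2) unique[OF that]] T_eq[OF that] by simp
  have strict: "T i t = t" if "i \<in> {1..k}" "t \<in> \<Theta>" "L (T i t) = L t" for i t
    using section_arg_max_strict_ascent(3)[OF that(2) unique[OF that(1,2)]]
      T_eq[OF that(1,2)] that(3) by simp
  have sweep_ascent: "sweep T k t \<in> \<Theta> \<and> L t \<le> L (sweep T k t) \<and>
    (L (sweep T k t) = L t \<longrightarrow> sweep T k t = t \<and> (\<forall>i\<in>{1..k}. T i t = t))"
    if "t \<in> \<Theta>" for t
    by (rule sweep_strict_ascent) (fact maps ascent strict that)+
  have contL: "continuous_on \<Theta> L"
    by (rule differentiable_imp_continuous_on[OF assms(2)])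
  have contS: "continuous_on \<Theta> (sweep T k)"
    using continuous_on_sweep[of k \<Theta> T] maps assms(8) by blast
  have mapsS: "sweep T k t \<in> \<Theta>" and ascentS: "L t \<le> L (sweep T k t)" if "t \<in> \<Theta>" for t
    using sweep_ascent[OF that] by blast+
  obtain l where l: "(\<lambda>n. L (\<theta> n)) \<longlonglongrightarrow> l"
    and acc: "\<And>\<alpha>. \<alpha> \<in> accumulation_points \<theta> \<Longrightarrow>
      \<alpha> \<in> \<Theta> \<and> L \<alpha> = l \<and> L (sweep T k \<alpha>) = l"
    using ascent_iteration_accumulation[of \<Theta> L "sweep T k" \<theta>,
        OF contL contS mapsS ascentS assms(3,4,10)] by blast
  have "L \<alpha> = l \<and> likelihood_eq L \<alpha>" if "\<alpha> \<in> accumulation_points \<theta>" for \<alpha>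
  proof -
    have \<alpha>: "\<alpha> \<in> \<Theta>" "L \<alpha> = l" "L (sweep T k \<alpha>) = L \<alpha>"
      using acc[OF that] by simp_all
    have "\<forall>i\<in>{1..k}. T i \<alpha> = \<alpha>"
      using sweep_ascent[of \<alpha>] \<alpha> by blast
    then have "\<forall>i\<in>{1..k}. is_arg_max L (\<lambda>u. u \<in> level_section \<Theta> (g i) \<alpha>) \<alpha>"
      using arg_max_on_is_arg_max[OF unique] T_eq \<alpha>(1) by metis
    with assms(9) \<alpha>(1,2) show ?thesis by blast
  qed
  with l show ?thesis by blast
qed

end
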